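(* Let $0<\alpha<1$ and define, for $0<t<1$, $$\beta_1(t)=1,\qquad \beta_2(t)=t^{\alpha},\qquad \beta_3(t)=(1-t)^{-\alpha}.$$ For any measurable $f:[0,1]\to\mathbb R$ satisfying $$\sup_{0<s\le 1}|f(s)|\,s^{1-\alpha}<\infty,$$ we have $$\int_0^1\int_0^t\frac{f(s)f(t)}{(t-s)^{\alpha}}\,\beta_i(t)\,ds\,dt\ \ge\ 0,\qquad i=1,2,3.$$ *)

theory Defs
  imports "HOL-Analysis.Analysis"
begin

text \<open>
  The weights \<open>\<beta>\<^sub>1, \<beta>\<^sub>2, \<beta>\<^sub>3\<close>, indexed by \<open>i \<in> {1, 2, 3}\<close>. Only arguments \<open>0 < t < 1\<close>
  are relevant; there every base of \<^const>\<open>powr\<close> is positive. The value at any other index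
  is irrelevant.
\<close>

definition beta_weight :: "real \<Rightarrow> nat \<Rightarrow> real \<Rightarrow> real" where
  "beta_weight \<alpha> i t =
     (if i = 1 then 1
      else if i = 2 then t powr \<alpha>
      else (1 - t) powr (- \<alpha>))"

end

theory Submission
  imports Defs
begin

text \<open>
  Fold the triangle \<open>0 < s < t < 1\<close> along the diagonal: the integral becomes half of
  \<open>\<integral>\<integral> f(s) f(t) K(s, t)\<close> over the unit square, where \<open>K\<close> is the symmetric kernel equal to
  \<open>(t - s)\<^sup>-\<^sup>\<alpha> \<beta>\<^sub>i(t)\<close> for \<open>s < t\<close>. The claim is that \<open>K\<close> is positive definite.

  Put \<open>p = min (\<phi> s) (\<phi> t)\<close> and \<open>q = max (\<phi> s) (\<phi> t)\<close> with \<open>\<phi> s = s\<close> for the first two weights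
  and \<open>\<phi> s = 1 - s\<close> for the third one. Then all three kernels have the form
  \<open>p\<^sup>\<delta> q\<^sup>\<gamma> (q - p)\<^sup>-\<^sup>\<alpha>\<close>, with \<open>(\<gamma>, \<delta>)\<close> equal to \<open>(0, 0)\<close>, \<open>(\<alpha>, 0)\<close> and \<open>(0, -\<alpha>)\<close>. The binomial series
  of \<open>(1 - p/q)\<^sup>-\<^sup>\<alpha>\<close> has nonnegative coefficients \<open>c\<^sub>k\<close>. Since \<open>p q = \<phi> s \<phi> t\<close>, trading each power
  of \<open>q\<close> for a power of \<open>p q\<close> turns its \<open>k\<close>-th term into
  \<open>c\<^sub>k (\<phi> s \<phi> t)\<^sup>e min (\<phi> s) (\<phi> t)\<^sup>r\<close> with \<open>e = \<gamma> - \<alpha> - k\<close> and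
  \<open>r = 2 k + \<delta> + \<alpha> - \<gamma> \<ge> 0\<close> (\<open>sums_power_kernel\<close>). The factor \<open>(\<phi> s \<phi> t)\<^sup>e\<close> can be absorbed
  into \<open>f(s) f(t)\<close>, and \<open>min (\<phi> s) (\<phi> t)\<^sup>r\<close> is again a minimum, of \<open>\<phi> s\<^sup>r\<close> and \<open>\<phi> t\<^sup>r\<close>. A kernel
  \<open>min (\<psi> s) (\<psi> t)\<close> is a superposition of squares (\<open>min_kernel_nonneg\<close>), and the terms are summed
  by dominated convergence, the kernel itself providing the bound (\<open>min_kernel_series_nonneg\<close>).

  Absolute convergence comes from \<open>\<bar>f(s)\<bar> \<le> C s\<^sup>\<alpha>\<^sup>-\<^sup>1\<close> and \<open>\<beta>\<^sub>i(t) \<le> (1 - t)\<^sup>-\<^sup>\<alpha>\<close>: the integral of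
  \<open>s\<^sup>\<alpha>\<^sup>-\<^sup>1 (t - s)\<^sup>-\<^sup>\<alpha>\<close> over \<open>0 < s < t\<close> is the Beta value \<open>B(\<alpha>, 1 - \<alpha>)\<close> for every \<open>t\<close>, and
  what remains in \<open>t\<close> is the integrand of the same Beta integral. Fubini's theorem is used for products of
  Borel measures, so \<open>f\<close> is first replaced by a Borel function that agrees with it almost everywhere.
\<close>

section \<open>Positive definite kernels built from minima\<close>

text \<open>
  By the layer-cake formula \<open>min (\<psi> x) (\<psi> y)\<close> is the integral over \<open>r \<ge> 0\<close> of the product of the
  indicators of \<open>r < \<psi> x\<close> and \<open>r < \<psi> y\<close>. By Fubini's theorem the form is therefore the integral over
  \<open>r\<close> of the square of \<open>\<integral> u\<close> over the superlevel set of \<open>\<psi>\<close>.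
\<close>

lemma min_kernel_nonneg:
  fixes u \<psi> :: "'a \<Rightarrow> real"
  assumes "sigma_finite_measure M"
    and [measurable]: "u \<in> borel_measurable M" "\<psi> \<in> borel_measurable M"
    and \<psi>: "\<And>x. \<psi> x \<ge> 0"
    and int: "integrable (M \<Otimes>\<^sub>M M) (\<lambda>(x, y). u x * u y * min (\<psi> x) (\<psi> y))"
  shows "(\<integral>(x, y). u x * u y * min (\<psi> x) (\<psi> y) \<partial>(M \<Otimes>\<^sub>M M)) \<ge> 0"
proof -
  interpret M: sigma_finite_measure M by fact
  interpret MM: pair_sigma_finite M M ..
  interpret MM2: sigma_finite_measure "M \<Otimes>\<^sub>M M" by (rule MM.sigma_finite_measure_axioms)
  interpret P: pair_sigma_finite "M \<Otimes>\<^sub>M M" "lborel :: real measure" ..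
  define v where "v r x = u x * (if 0 \<le> r \<and> r < \<psi> x then 1 else 0)" for r x
  have v_meas [measurable]: "(\<lambda>(x, r). v r x) \<in> borel_measurable (M \<Otimes>\<^sub>M lborel)"
    unfolding v_def by measurable
  have layer: "v r x * v r y = u x * u y * indicator {0..<min (\<psi> x) (\<psi> y)} r" for r x y
    by (auto simp: v_def indicator_def)
  have layer_int: "(\<integral>r. v r x * v r y \<partial>lborel) = u x * u y * min (\<psi> x) (\<psi> y)" for x y
    unfolding layer using \<psi>[of x] \<psi>[of y] by simp
  have joint: "integrable ((M \<Otimes>\<^sub>M M) \<Otimes>\<^sub>M lborel) (\<lambda>(p, r). v r (fst p) * v r (snd p))"
  proof (rule P.Fubini_integrable)
    show "(\<lambda>(p, r). v r (fst p) * v r (snd p)) \<in> borel_measurable ((M \<Otimes>\<^sub>M M) \<Otimes>\<^sub>M lborel)"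
      unfolding v_def by measurable
    have "(\<integral>r. norm (v r x * v r y) \<partial>lborel) = norm (u x * u y * min (\<psi> x) (\<psi> y))" for x y
      unfolding layer using \<psi>[of x] \<psi>[of y] by (simp add: abs_mult)
    then have "(\<lambda>p. \<integral>r. norm (case (p, r) of (p, r) \<Rightarrow> v r (fst p) * v r (snd p)) \<partial>lborel) =
      (\<lambda>p. norm (case p of (x, y) \<Rightarrow> u x * u y * min (\<psi> x) (\<psi> y)))"
      by (auto simp: fun_eq_iff)
    then show "integrable (M \<Otimes>\<^sub>M M)
        (\<lambda>p. \<integral>r. norm (case (p, r) of (p, r) \<Rightarrow> v r (fst p) * v r (snd p)) \<partial>lborel)"
      using integrable_norm[OF int] by simp
    show "AE p in M \<Otimes>\<^sub>M M. integrable lborel (\<lambda>r. case (p, r) of (p, r) \<Rightarrow> v r (fst p) * v r (snd p))"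
    proof (rule AE_I2)
      fix p :: "'a \<times> 'a"
      have "integrable lborel (\<lambda>r. v r (fst p) * v r (snd p))"
        unfolding layer using \<psi>[of "fst p"] \<psi>[of "snd p"] by (intro integrable_mult_right integrable_real_indicator) auto
      then show "integrable lborel (\<lambda>r. case (p, r) of (p, r) \<Rightarrow> v r (fst p) * v r (snd p))" by simp
    qed
  qed
  have "(\<integral>(x, y). u x * u y * min (\<psi> x) (\<psi> y) \<partial>(M \<Otimes>\<^sub>M M)) =
      (\<integral>p. \<integral>r. v r (fst p) * v r (snd p) \<partial>lborel \<partial>(M \<Otimes>\<^sub>M M))"
    by (simp add: layer_int case_prod_unfold)
  also have "\<dots> = (\<integral>r. \<integral>p. v r (fst p) * v r (snd p) \<partial>(M \<Otimes>\<^sub>M M) \<partial>lborel)"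
    using P.Fubini_integral[OF joint] by simp
  also have "\<dots> \<ge> 0"
  proof (rule integral_nonneg_AE)
    have "AE r in lborel. integrable (M \<Otimes>\<^sub>M M) (\<lambda>p. v r (fst p) * v r (snd p))"
      using P.AE_integrable_snd[OF joint] .
    then show "AE r in lborel. 0 \<le> (\<integral>p. v r (fst p) * v r (snd p) \<partial>(M \<Otimes>\<^sub>M M))"
    proof eventually_elim
      case (elim r)
      have "(\<integral>p. v r (fst p) * v r (snd p) \<partial>(M \<Otimes>\<^sub>M M)) = (\<integral>x. v r x \<partial>M) * (\<integral>x. v r x \<partial>M)"
        using MM.integral_fst'[OF elim] by simp
      then show ?case by simp
    qed
  qed
  finally show ?thesis .
qed

text \<open>
  All terms of the kernel are nonnegative, so each partial sum of the integrand is bounded by the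
  integrand itself. Hence integrability of the whole form is enough both for integrability of the
  single terms and for passing to the limit.
\<close>

lemma min_kernel_series_nonneg:
  fixes K :: "'a \<Rightarrow> 'a \<Rightarrow> real" and h :: "'a \<Rightarrow> real" and a \<psi> :: "nat \<Rightarrow> 'a \<Rightarrow> real"
  assumes M: "sigma_finite_measure M"
    and [measurable]: "h \<in> borel_measurable M" "\<And>k. a k \<in> borel_measurable M"
      "\<And>k. \<psi> k \<in> borel_measurable M"
    and a: "\<And>k x. a k x \<ge> 0" and \<psi>: "\<And>k x. \<psi> k x \<ge> 0"
    and int: "integrable (M \<Otimes>\<^sub>M M) (\<lambda>(x, y). h x * h y * K x y)"
    and sums: "AE (x, y) in M \<Otimes>\<^sub>M M. h x \<noteq> 0 \<longrightarrow> h y \<noteq> 0 \<longrightarrow>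
      (\<lambda>k. a k x * a k y * min (\<psi> k x) (\<psi> k y)) sums K x y"
  shows "(\<integral>(x, y). h x * h y * K x y \<partial>(M \<Otimes>\<^sub>M M)) \<ge> 0"
proof -
  define \<kappa> where "\<kappa> n p = (case p of (x, y) \<Rightarrow> a n x * a n y * min (\<psi> n x) (\<psi> n y))" for n p
  define T where "T n p = (case p of (x, y) \<Rightarrow> (h x * a n x) * (h y * a n y) * min (\<psi> n x) (\<psi> n y))" for n p
  define F where "F = (\<lambda>(x, y). h x * h y * K x y)"
  have F: "integrable (M \<Otimes>\<^sub>M M) F" using int by (simp add: F_def)
  have [measurable]: "T n \<in> borel_measurable (M \<Otimes>\<^sub>M M)" for n
    unfolding T_def by measurable
  have \<kappa>_nonneg: "\<kappa> n p \<ge> 0" for n p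
    using a \<psi> by (auto simp: \<kappa>_def split: prod.split)
  have T_eq: "T n p = h (fst p) * h (snd p) * \<kappa> n p" for n p
    by (simp add: T_def \<kappa>_def case_prod_beta)
  have F_eq: "F p = h (fst p) * h (snd p) * K (fst p) (snd p)" for p
    by (simp add: F_def case_prod_beta)
  have sums': "AE p in M \<Otimes>\<^sub>M M. h (fst p) * h (snd p) \<noteq> 0 \<longrightarrow> (\<lambda>n. \<kappa> n p) sums K (fst p) (snd p)"
    using sums by eventually_elim (auto simp: \<kappa>_def)
  have conv: "AE p in M \<Otimes>\<^sub>M M. (\<lambda>n. \<Sum>i<n. T i p) \<longlonglongrightarrow> F p"
    using sums'
  proof eventually_elim
    case (elim p)
    show ?case
    proof (cases "h (fst p) * h (snd p) = 0")
      case True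
      then show ?thesis by (auto simp: T_eq F_eq)
    next
      case False
      with elim show ?thesis
        by (simp add: T_eq F_eq sums_def tendsto_mult_left flip: sum_distrib_left)
    qed
  qed
  have dom: "AE p in M \<Otimes>\<^sub>M M. \<bar>\<Sum>i\<in>I. T i p\<bar> \<le> \<bar>F p\<bar>" if "finite I" for I
    using sums'
  proof eventually_elim
    case (elim p)
    show ?case
    proof (cases "h (fst p) * h (snd p) = 0")
      case False
      with elim have K: "(\<lambda>n. \<kappa> n p) sums K (fst p) (snd p)" by simp
      have "(\<Sum>i\<in>I. \<kappa> i p) \<le> K (fst p) (snd p)"
        using sum_le_suminf[OF sums_summable[OF K] that] \<kappa>_nonneg sums_unique[OF K] by simp
      moreover have "0 \<le> (\<Sum>i\<in>I. \<kappa> i p)" by (intro sum_nonneg \<kappa>_nonneg)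
      ultimately show ?thesis
        unfolding T_eq F_eq by (simp add: abs_mult mult_left_mono flip: sum_distrib_left)
    qed (auto simp: T_eq)
  qed
  have intT: "integrable (M \<Otimes>\<^sub>M M) (T n)" for n
    by (rule Bochner_Integration.integrable_bound[OF F]) (use dom[of "{n}"] in simp_all)
  have "(\<integral>p. T n p \<partial>(M \<Otimes>\<^sub>M M)) \<ge> 0" for n
    using min_kernel_nonneg[OF M, of "\<lambda>x. h x * a n x" "\<psi> n"] \<psi> intT[of n]
    by (simp add: T_def[abs_def])
  then have pos: "(\<integral>p. (\<Sum>i<n. T i p) \<partial>(M \<Otimes>\<^sub>M M)) \<ge> 0" for n
    by (subst Bochner_Integration.integral_sum) (auto intro: intT sum_nonneg)
  have "(\<lambda>n. \<integral>p. (\<Sum>i<n. T i p) \<partial>(M \<Otimes>\<^sub>M M)) \<longlonglongrightarrow> (\<integral>p. F p \<partial>(M \<Otimes>\<^sub>M M))"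
    by (rule integral_dominated_convergence[where w = "\<lambda>p. \<bar>F p\<bar>"])
      (use F conv dom in auto)
  then have "(\<integral>p. F p \<partial>(M \<Otimes>\<^sub>M M)) \<ge> 0"
    by (rule LIMSEQ_le_const) (use pos in auto)
  then show ?thesis by (simp add: F_def)
qed

section \<open>The power kernel as a series of minima\<close>

text \<open>
  This is the binomial series of \<open>(1 - p/q)\<^sup>-\<^sup>\<alpha>\<close> multiplied by \<open>p\<^sup>\<delta> q\<^sup>\<gamma>\<^sup>-\<^sup>\<alpha>\<close>, arranged so that \<open>q\<close> occurs
  only in the symmetric product \<open>p q\<close>.
\<close>

lemma sums_powr_diff:
  fixes \<alpha> p q \<gamma> \<delta> :: real
  assumes "0 < p" "p < q"
  shows "(\<lambda>k. pochhammer \<alpha> k / fact k *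
      ((p * q) powr (\<gamma> - \<alpha> - real k) * p powr (2 * real k + (\<delta> + \<alpha> - \<gamma>))))
    sums (p powr \<delta> * q powr \<gamma> / (q - p) powr \<alpha>)"
proof -
  have "(\<lambda>k. ((- \<alpha>) gchoose k) * (- (p / q)) ^ k) sums (1 + - (p / q)) powr (- \<alpha>)"
    by (rule gen_binomial_real) (use assms in simp)
  then have "(\<lambda>k. q powr (\<gamma> - \<alpha>) * p powr \<delta> * (((- \<alpha>) gchoose k) * (- (p / q)) ^ k))
      sums (q powr (\<gamma> - \<alpha>) * p powr \<delta> * (1 + - (p / q)) powr (- \<alpha>))"
    by (rule sums_mult)
  moreover have "q powr (\<gamma> - \<alpha>) * p powr \<delta> * (((- \<alpha>) gchoose k) * (- (p / q)) ^ k) =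
      pochhammer \<alpha> k / fact k *
      ((p * q) powr (\<gamma> - \<alpha> - real k) * p powr (2 * real k + (\<delta> + \<alpha> - \<gamma>)))" for k
  proof -
    have c: "((- \<alpha>) gchoose k) * (- (p / q)) ^ k = pochhammer \<alpha> k / fact k * (p powr real k / q powr real k)"
      using assms by (simp add: gbinomial_pochhammer power_minus[of "p / q"] powr_realpow power_divide
          flip: power_mult_distrib mult.assoc)
    have "(p * q) powr (\<gamma> - \<alpha> - real k) * p powr (2 * real k + (\<delta> + \<alpha> - \<gamma>)) =
        q powr (\<gamma> - \<alpha> - real k) * (p powr (\<gamma> - \<alpha> - real k) * p powr (2 * real k + (\<delta> + \<alpha> - \<gamma>)))"
      using assms by (simp add: powr_mult)
    also have "\<dots> = q powr (\<gamma> - \<alpha> - real k) * p powr (\<delta> + real k)"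
      by (simp add: add.commute flip: powr_add)
    also have "\<dots> = q powr (\<gamma> - \<alpha>) * p powr \<delta> * (p powr real k / q powr real k)"
      by (simp add: powr_add powr_diff)
    finally show ?thesis unfolding c by simp
  qed
  moreover have "q powr (\<gamma> - \<alpha>) * p powr \<delta> * (1 + - (p / q)) powr (- \<alpha>) =
      p powr \<delta> * q powr \<gamma> / (q - p) powr \<alpha>"
  proof -
    have "1 + - (p / q) = (q - p) / q" using assms by (simp add: field_simps)
    then show ?thesis using assms by (simp add: powr_divide powr_minus powr_diff field_simps)
  qed
  ultimately show ?thesis by simp
qed

text \<open>
  The condition \<open>\<gamma> \<le> \<alpha> + \<delta>\<close> makes all exponents of the minimum nonnegative, so that raising to these
  powers commutes with taking the minimum.
\<close>

lemma sums_power_kernel: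
  fixes \<alpha> x y \<gamma> \<delta> :: real
  assumes "0 < x" "0 < y" "x \<noteq> y" "\<alpha> > 0" "\<gamma> \<le> \<alpha> + \<delta>"
  shows "(\<lambda>k. x powr (\<gamma> - \<alpha> - real k) * y powr (\<gamma> - \<alpha> - real k) *
      min (pochhammer \<alpha> k / fact k * x powr (2 * real k + (\<delta> + \<alpha> - \<gamma>)))
          (pochhammer \<alpha> k / fact k * y powr (2 * real k + (\<delta> + \<alpha> - \<gamma>))))
    sums (min x y powr \<delta> * max x y powr \<gamma> / \<bar>x - y\<bar> powr \<alpha>)"
  using assms(1-3)
proof (induction x y rule: linorder_wlog)
  case (sym x y)
  then show ?case by (simp add: mult.commute min.commute max.commute abs_minus_commute)
next
  case (le x y)
  have "min (pochhammer \<alpha> k / fact k * x powr (2 * real k + (\<delta> + \<alpha> - \<gamma>)))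
          (pochhammer \<alpha> k / fact k * y powr (2 * real k + (\<delta> + \<alpha> - \<gamma>))) =
        pochhammer \<alpha> k / fact k * x powr (2 * real k + (\<delta> + \<alpha> - \<gamma>))" for k
    using le assms(4,5)
    by (intro min_absorb1 mult_left_mono powr_mono2 divide_nonneg_nonneg less_imp_le[OF pochhammer_pos]) auto
  then show ?case
    using sums_powr_diff[of x y \<alpha> \<gamma> \<delta>] le by (simp add: powr_mult mult_ac min_absorb1 max_absorb2)
qed

section \<open>Absolute convergence\<close>

lemma has_bochner_integral_Beta_Ioo:
  fixes a b :: real
  assumes "0 < a" "0 < b"
  shows "has_bochner_integral lborel
    (\<lambda>s. indicator {0<..<1} s * (s powr (a - 1) * (1 - s) powr (b - 1))) (Beta a b)"
proof -
  let ?f = "\<lambda>s. s powr (a - 1) * (1 - s) powr (b - 1)"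
  have I: "set_integrable lborel {0<..<1} ?f"
    using integrable_Beta[OF assms] by (rule set_integrable_subset) auto
  have "(?f has_integral Beta a b) {0<..<1}"
    using has_integral_Beta_real[OF assms] by (simp add: has_integral_Icc_iff_Ioo)
  then have "(LINT s:{0<..<1}|lborel. ?f s) = Beta a b"
    using set_borel_integral_eq_integral(2)[OF I] by (simp add: integral_unique)
  then show ?thesis
    using I by (simp add: has_bochner_integral_iff set_integrable_def set_lebesgue_integral_def)
qed

text \<open>
  The value is independent of \<open>t\<close> because the integrand is homogeneous of degree \<open>-1\<close> in \<open>(s, t)\<close>.
\<close>

lemma has_bochner_integral_Beta_scaled:
  fixes \<alpha> t :: real
  assumes "0 < \<alpha>" "\<alpha> < 1" "0 < t"
  shows "has_bochner_integral lborel
    (\<lambda>s. indicator {0<..<t} s * (s powr (\<alpha> - 1) / (t - s) powr \<alpha>)) (Beta \<alpha> (1 - \<alpha>))"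
proof -
  let ?f = "\<lambda>s. indicator {0<..<t} s * (s powr (\<alpha> - 1) / (t - s) powr \<alpha>)"
  have "?f (0 + t * x) = (1 / t) * (indicator {0<..<1} x * (x powr (\<alpha> - 1) * (1 - x) powr ((1 - \<alpha>) - 1)))" for x
  proof (cases "x \<in> {0<..<1}")
    case True
    then have x: "0 < x" "x < 1" by auto
    have "t - t * x = t * (1 - x)" by (simp add: algebra_simps)
    then have "(t * x) powr (\<alpha> - 1) / (t - t * x) powr \<alpha> =
        (t powr (\<alpha> - 1) / t powr \<alpha>) * (x powr (\<alpha> - 1) / (1 - x) powr \<alpha>)"
      using x assms by (simp add: powr_mult)
    also have "t powr (\<alpha> - 1) / t powr \<alpha> = 1 / t"
      using assms by (simp add: powr_diff)
    finally show ?thesis using x assms by (simp add: powr_minus divide_inverse)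
  next
    case False
    then show ?thesis using assms by (auto simp: indicator_def zero_less_mult_iff)
  qed
  moreover have "has_bochner_integral lborel
      (\<lambda>x. (1 / t) * (indicator {0<..<1} x * (x powr (\<alpha> - 1) * (1 - x) powr ((1 - \<alpha>) - 1))))
      ((1 / t) * Beta \<alpha> (1 - \<alpha>))"
    by (intro has_bochner_integral_mult_right has_bochner_integral_Beta_Ioo) (use assms in auto)
  moreover have "(1 / t) * Beta \<alpha> (1 - \<alpha>) = Beta \<alpha> (1 - \<alpha>) /\<^sub>R \<bar>t\<bar>"
    using assms by (simp add: divide_inverse)
  ultimately have "has_bochner_integral lborel (\<lambda>x. ?f (0 + t * x)) (Beta \<alpha> (1 - \<alpha>) /\<^sub>R \<bar>t\<bar>)"
    by (simp only:)
  then show ?thesis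
    using lborel_has_bochner_integral_real_affine_iff[of t ?f "Beta \<alpha> (1 - \<alpha>)" 0] assms by simp
qed

lemma integrable_half_square_majorant:
  fixes \<alpha> :: real
  assumes "0 < \<alpha>" "\<alpha> < 1"
  shows "integrable (lborel \<Otimes>\<^sub>M lborel) (\<lambda>(t, s). if 0 < s \<and> s < t \<and> t < 1
    then (t powr (\<alpha> - 1) * (1 - t) powr (- \<alpha>)) * (s powr (\<alpha> - 1) / (t - s) powr \<alpha>) else 0)"
    (is "integrable _ ?G")
proof (rule lborel_pair.Fubini_integrable)
  let ?b = "\<lambda>t. indicator {0<..<1} t * (t powr (\<alpha> - 1) * (1 - t) powr ((1 - \<alpha>) - 1))"
  have inner: "has_bochner_integral lborel (\<lambda>s. ?G (t, s)) (?b t * Beta \<alpha> (1 - \<alpha>))" for t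
  proof (cases "t \<in> {0<..<1}")
    case True
    have "has_bochner_integral lborel
        (\<lambda>s. ?b t * (indicator {0<..<t} s * (s powr (\<alpha> - 1) / (t - s) powr \<alpha>))) (?b t * Beta \<alpha> (1 - \<alpha>))"
      by (intro has_bochner_integral_mult_right has_bochner_integral_Beta_scaled) (use assms True in auto)
    then show ?thesis
      by (rule has_bochner_integral_cong[THEN iffD1, rotated 3]) (use True in \<open>auto simp: indicator_def\<close>)
  next
    case False
    then have "(\<lambda>s. ?G (t, s)) = (\<lambda>s. 0)" by (auto simp: fun_eq_iff)
    then show ?thesis using False by (simp add: has_bochner_integral_zero)
  qed
  have G_nonneg: "?G p \<ge> 0" for p
    by (auto split: prod.split)
  show "?G \<in> borel_measurable (lborel \<Otimes>\<^sub>M lborel)" by measurable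
  show "AE t in lborel. integrable lborel (\<lambda>s. ?G (t, s))"
    using inner by (auto simp: has_bochner_integral_iff)
  have "(\<lambda>t. \<integral>s. norm (?G (t, s)) \<partial>lborel) = (\<lambda>t. ?b t * Beta \<alpha> (1 - \<alpha>))"
    using inner G_nonneg by (simp only: has_bochner_integral_iff real_norm_def abs_of_nonneg)
  moreover have "integrable lborel (\<lambda>t. ?b t * Beta \<alpha> (1 - \<alpha>))"
    using has_bochner_integral_Beta_Ioo[of \<alpha> "1 - \<alpha>"] assms
    by (intro integrable_mult_left) (auto simp: has_bochner_integral_iff)
  ultimately show "integrable lborel (\<lambda>t. \<integral>s. norm (?G (t, s)) \<partial>lborel)" by simp
qed

lemma integrable_half_square_form:
  fixes \<alpha> C :: real and h w :: "real \<Rightarrow> real"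
  assumes \<alpha>: "0 < \<alpha>" "\<alpha> < 1"
    and [measurable]: "h \<in> borel_measurable borel" "w \<in> borel_measurable borel"
    and h: "\<And>s. s \<in> {0<..<1} \<Longrightarrow> \<bar>h s\<bar> \<le> C * s powr (\<alpha> - 1)" "\<And>s. s \<notin> {0<..<1} \<Longrightarrow> h s = 0"
    and w: "\<And>t. t \<in> {0<..<1} \<Longrightarrow> \<bar>w t\<bar> \<le> (1 - t) powr (- \<alpha>)"
  shows "integrable (lborel \<Otimes>\<^sub>M lborel)
    (\<lambda>(t, s). if s < t then h s * h t / (t - s) powr \<alpha> * w t else 0)"
proof (rule Bochner_Integration.integrable_bound)
  show "integrable (lborel \<Otimes>\<^sub>M lborel) (\<lambda>p. C\<^sup>2 * (case p of (t, s) \<Rightarrow> if 0 < s \<and> s < t \<and> t < 1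
    then (t powr (\<alpha> - 1) * (1 - t) powr (- \<alpha>)) * (s powr (\<alpha> - 1) / (t - s) powr \<alpha>) else 0))"
    by (intro integrable_mult_right integrable_half_square_majorant \<alpha>)
  show "(\<lambda>(t, s). if s < t then h s * h t / (t - s) powr \<alpha> * w t else 0) \<in> borel_measurable (lborel \<Otimes>\<^sub>M lborel)"
    by measurable
  show "AE p in lborel \<Otimes>\<^sub>M lborel.
      norm (case p of (t, s) \<Rightarrow> if s < t then h s * h t / (t - s) powr \<alpha> * w t else 0)
      \<le> norm (C\<^sup>2 * (case p of (t, s) \<Rightarrow> if 0 < s \<and> s < t \<and> t < 1
    then (t powr (\<alpha> - 1) * (1 - t) powr (- \<alpha>)) * (s powr (\<alpha> - 1) / (t - s) powr \<alpha>) else 0))"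
  proof (intro AE_I2, clarify)
    fix t s :: real
    show "norm (if s < t then h s * h t / (t - s) powr \<alpha> * w t else 0)
      \<le> norm (C\<^sup>2 * (if 0 < s \<and> s < t \<and> t < 1
    then (t powr (\<alpha> - 1) * (1 - t) powr (- \<alpha>)) * (s powr (\<alpha> - 1) / (t - s) powr \<alpha>) else 0))"
    proof (cases "0 < s \<and> s < t \<and> t < 1")
      case True
      then have "\<bar>h s\<bar> * \<bar>h t\<bar> / (t - s) powr \<alpha> * \<bar>w t\<bar>
          \<le> (C * s powr (\<alpha> - 1)) * (C * t powr (\<alpha> - 1)) / (t - s) powr \<alpha> * (1 - t) powr (- \<alpha>)"
        by (intro mult_mono divide_right_mono h w mult_nonneg_nonneg divide_nonneg_nonneg
            order_trans[OF abs_ge_zero h(1)]) auto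
      with True show ?thesis by (simp add: abs_mult power2_eq_square mult_ac)
    next
      case False
      then have "s < t \<Longrightarrow> h s = 0 \<or> h t = 0" using h(2)[of s] h(2)[of t] by auto
      with False show ?thesis by auto
    qed
  qed
qed

section \<open>Positivity of the half-square form\<close>

text \<open>
  The half-square integrand plus its mirror image is a form on the whole plane, whose integral is twice
  the given one. The coordinate \<open>\<phi>\<close> may be decreasing, which is why the kernel is written with
  minima and maxima of \<open>\<phi>\<close>: then no change of variables is needed for weights singular at \<open>1\<close>.
\<close>

lemma half_square_form_nonneg:
  fixes \<alpha> \<gamma> \<delta> :: real and h w \<phi> :: "real \<Rightarrow> real"
  assumes \<alpha>: "0 < \<alpha>"
    and meas [measurable]: "h \<in> borel_measurable borel" "\<phi> \<in> borel_measurable borel"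
    and h: "\<And>s. s \<notin> {0<..<1} \<Longrightarrow> h s = 0"
    and int: "integrable (lborel \<Otimes>\<^sub>M lborel)
      (\<lambda>(t, s). if s < t then h s * h t / (t - s) powr \<alpha> * w t else 0)"
    and exponents: "\<gamma> \<le> \<alpha> + \<delta>"
    and \<phi>_pos: "\<And>s. s \<in> {0<..<1} \<Longrightarrow> \<phi> s > 0"
    and \<phi>_inj: "inj_on \<phi> {0<..<1}"
    and kernel: "\<And>s t. 0 < s \<Longrightarrow> s < t \<Longrightarrow> t < 1 \<Longrightarrow>
      w t / (t - s) powr \<alpha> =
      min (\<phi> s) (\<phi> t) powr \<delta> * max (\<phi> s) (\<phi> t) powr \<gamma> / \<bar>\<phi> s - \<phi> t\<bar> powr \<alpha>"
  shows "(\<integral>t. (\<integral>s. (if s < t then h s * h t / (t - s) powr \<alpha> * w t else 0) \<partial>lborel) \<partial>lborel) \<ge> 0"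
proof -
  define H where "H t s = (if s < t then h s * h t / (t - s) powr \<alpha> * w t else 0)" for t s
  define K where "K s t = min (\<phi> s) (\<phi> t) powr \<delta> * max (\<phi> s) (\<phi> t) powr \<gamma> / \<bar>\<phi> s - \<phi> t\<bar> powr \<alpha>" for s t
  have K_sym: "K s t = K t s" for s t
    by (simp add: K_def min.commute max.commute abs_minus_commute)
  have H: "integrable (lborel \<Otimes>\<^sub>M lborel) (\<lambda>(t, s). H t s)"
    using int by (simp add: H_def)
  have H': "integrable (lborel \<Otimes>\<^sub>M lborel) (\<lambda>(t, s). H s t)"
    using lborel_pair.integrable_product_swap[OF H] by simp
  have H_eq: "H t s = h t * h s * K t s" if "s < t" for s t
  proof (cases "s \<in> {0<..<1} \<and> t \<in> {0<..<1}")
    case True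
    then have "H t s = h t * h s * (w t / (t - s) powr \<alpha>)" using that by (simp add: H_def)
    also have "\<dots> = h t * h s * K s t" using kernel[of s t] True that by (simp add: K_def)
    finally show ?thesis by (simp add: K_sym)
  next
    case False
    then show ?thesis using h[of s] h[of t] by (auto simp: H_def)
  qed
  have sym: "H t s + H s t = h t * h s * K t s" for s t
  proof (cases s t rule: linorder_cases)
    case less
    then have "H s t = 0" by (simp add: H_def)
    then show ?thesis using H_eq[OF less] by simp
  next
    case equal
    \<comment> \<open>On the diagonal both sides vanish, the right one because division by zero gives zero.\<close>
    then show ?thesis by (simp add: H_def K_def)
  next
    case greater
    then have "H t s = 0" by (simp add: H_def)
    then show ?thesis using H_eq[OF greater] K_sym[of s t] by simp
  qed
  have off_diagonal: "AE p in lborel \<Otimes>\<^sub>M lborel. fst p \<noteq> (snd p :: real)"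
  proof (rule lborel_pair.AE_pair_measure)
    show "AE x in lborel. AE y in lborel. fst (x, y) \<noteq> snd (x, y :: real)"
      using AE_lborel_singleton by (auto simp: eq_commute)
  qed measurable
  have "0 \<le> (\<integral>(t, s). h t * h s * K t s \<partial>(lborel \<Otimes>\<^sub>M lborel))"
  proof (rule min_kernel_series_nonneg[where
        a = "\<lambda>k x. \<phi> x powr (\<gamma> - \<alpha> - real k)" and
        \<psi> = "\<lambda>k x. pochhammer \<alpha> k / fact k * \<phi> x powr (2 * real k + (\<delta> + \<alpha> - \<gamma>))"])
    show "sigma_finite_measure (lborel :: real measure)" ..
    show "integrable (lborel \<Otimes>\<^sub>M lborel) (\<lambda>(t, s). h t * h s * K t s)"
      using Bochner_Integration.integrable_add[OF H H'] by (simp add: case_prod_unfold sym)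
    show "0 \<le> pochhammer \<alpha> k / fact k * \<phi> x powr (2 * real k + (\<delta> + \<alpha> - \<gamma>))" for k x
      using \<alpha> by (intro mult_nonneg_nonneg divide_nonneg_nonneg less_imp_le[OF pochhammer_pos]) auto
    show "AE (t, s) in lborel \<Otimes>\<^sub>M lborel. h t \<noteq> 0 \<longrightarrow> h s \<noteq> 0 \<longrightarrow>
        (\<lambda>k. \<phi> t powr (\<gamma> - \<alpha> - real k) * \<phi> s powr (\<gamma> - \<alpha> - real k) *
          min (pochhammer \<alpha> k / fact k * \<phi> t powr (2 * real k + (\<delta> + \<alpha> - \<gamma>)))
              (pochhammer \<alpha> k / fact k * \<phi> s powr (2 * real k + (\<delta> + \<alpha> - \<gamma>)))) sums K t s"
      using off_diagonal
    proof eventually_elim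
      case (elim p)
      obtain t s where p: "p = (t, s)" by force
      have "(\<lambda>k. \<phi> t powr (\<gamma> - \<alpha> - real k) * \<phi> s powr (\<gamma> - \<alpha> - real k) *
          min (pochhammer \<alpha> k / fact k * \<phi> t powr (2 * real k + (\<delta> + \<alpha> - \<gamma>)))
              (pochhammer \<alpha> k / fact k * \<phi> s powr (2 * real k + (\<delta> + \<alpha> - \<gamma>)))) sums K t s"
        if "h t \<noteq> 0" "h s \<noteq> 0"
      proof -
        have ts: "t \<in> {0<..<1}" "s \<in> {0<..<1}" using h that by blast+
        then have "\<phi> t \<noteq> \<phi> s" using \<phi>_inj elim p by (auto dest: inj_onD)
        then show ?thesis
          unfolding K_def using sums_power_kernel \<phi>_pos ts \<alpha> exponents by blast
      qed
      then show ?case by (simp add: p)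
    qed
  qed measurable
  also have "\<dots> = (\<integral>p. (case p of (t, s) \<Rightarrow> H t s) \<partial>(lborel \<Otimes>\<^sub>M lborel)) +
      (\<integral>p. (case p of (t, s) \<Rightarrow> H s t) \<partial>(lborel \<Otimes>\<^sub>M lborel))"
    using Bochner_Integration.integral_add[OF H H'] by (simp add: case_prod_unfold sym)
  also have "\<dots> = 2 * (\<integral>p. (case p of (t, s) \<Rightarrow> H t s) \<partial>(lborel \<Otimes>\<^sub>M lborel))"
    using lborel_pair.integral_product_swap[OF borel_measurable_integrable[OF H]] by simp
  also have "(\<integral>p. (case p of (t, s) \<Rightarrow> H t s) \<partial>(lborel \<Otimes>\<^sub>M lborel)) = (\<integral>t. (\<integral>s. H t s \<partial>lborel) \<partial>lborel)"
    using lborel_pair.integral_fst'[OF H] by simp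
  finally show ?thesis by (simp add: H_def)
qed

section \<open>The three weights\<close>

text \<open>
  The third weight dominates the other two, so a single majorant serves all three forms.
\<close>

lemma abs_beta_weight_le:
  fixes \<alpha> t :: real
  assumes "0 < \<alpha>" "t \<in> {0<..<1}"
  shows "\<bar>beta_weight \<alpha> i t\<bar> \<le> (1 - t) powr (- \<alpha>)"
proof -
  have "1 \<le> (1 - t) powr (- \<alpha>)"
    using powr_mono2'[of "- \<alpha>" "1 - t" 1] assms by simp
  moreover have "t powr \<alpha> \<le> 1"
    using powr_mono2[of \<alpha> t 1] assms by simp
  ultimately show ?thesis by (auto simp: beta_weight_def)
qed

lemma beta_weight_measurable [measurable]: "beta_weight \<alpha> i \<in> borel_measurable borel"
  unfolding beta_weight_def[abs_def] by measurable

lemma beta_weight_half_square_form_nonneg: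
  fixes \<alpha> :: real and h :: "real \<Rightarrow> real"
  assumes \<alpha>: "0 < \<alpha>" and i: "i \<in> {1, 2, 3}"
    and meas: "h \<in> borel_measurable borel"
    and h: "\<And>s. s \<notin> {0<..<1} \<Longrightarrow> h s = 0"
    and int: "integrable (lborel \<Otimes>\<^sub>M lborel)
      (\<lambda>(t, s). if s < t then h s * h t / (t - s) powr \<alpha> * beta_weight \<alpha> i t else 0)"
  shows "(\<integral>t. (\<integral>s. (if s < t then h s * h t / (t - s) powr \<alpha> * beta_weight \<alpha> i t else 0) \<partial>lborel) \<partial>lborel) \<ge> 0"
proof -
  consider "i = 1" | "i = 2" | "i = 3" using i by auto
  then show ?thesis
  proof cases
    case 1
    show ?thesis
      by (rule half_square_form_nonneg[OF \<alpha> meas _ h int, where \<phi> = "\<lambda>s. s" and \<gamma> = 0 and \<delta> = 0])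
        (use \<alpha> in \<open>auto simp: beta_weight_def 1\<close>)
  next
    case 2
    show ?thesis
      by (rule half_square_form_nonneg[OF \<alpha> meas _ h int, where \<phi> = "\<lambda>s. s" and \<gamma> = \<alpha> and \<delta> = 0])
        (use \<alpha> in \<open>auto simp: beta_weight_def 2 max_def\<close>)
  next
    case 3
    show ?thesis
      by (rule half_square_form_nonneg[OF \<alpha> meas _ h int, where \<phi> = "\<lambda>s. 1 - s" and \<gamma> = 0 and \<delta> = "- \<alpha>"])
        (use \<alpha> in \<open>auto simp: beta_weight_def 3 min_def inj_on_def\<close>)
  qed
qed

text \<open>
  A Borel representative of \<open>f\<close> may violate the bound on a null set; it is set to zero there, so that
  the bound holds at every point of the open interval and not just almost everywhere.
\<close>

lemma borel_representative:
  fixes f b :: "real \<Rightarrow> real"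
  assumes f: "f \<in> borel_measurable (lebesgue_on {0..1})"
    and [measurable]: "b \<in> borel_measurable borel"
    and bound: "\<And>s. s \<in> {0<..<1} \<Longrightarrow> \<bar>f s\<bar> \<le> b s"
  obtains h where "h \<in> borel_measurable borel" "\<And>s. s \<in> {0<..<1} \<Longrightarrow> \<bar>h s\<bar> \<le> b s"
    "\<And>s. s \<notin> {0<..<1} \<Longrightarrow> h s = 0" "AE s in lebesgue. s \<in> {0<..<1} \<longrightarrow> f s = h s"
proof -
  have "(\<lambda>s. indicator {0..1} s * f s) \<in> borel_measurable lebesgue"
    using f by (simp add: borel_measurable_restrict_space_iff)
  then obtain g where g [measurable]: "g \<in> borel_measurable lborel"
    and fg: "AE s in lborel. indicator {0..1} s * f s = g s"
    using completion_ex_borel_measurable_real by blast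
  define h where "h s = (if s \<in> {0<..<1} \<and> \<bar>g s\<bar> \<le> b s then g s else 0)" for s
  show ?thesis
  proof
    show "h \<in> borel_measurable borel"
      using g unfolding h_def[abs_def] by measurable
    show "\<bar>h s\<bar> \<le> b s" if "s \<in> {0<..<1}" for s
      using bound[OF that] by (auto simp: h_def)
    show "h s = 0" if "s \<notin> {0<..<1}" for s
      using that by (auto simp: h_def)
    show "AE s in lebesgue. s \<in> {0<..<1} \<longrightarrow> f s = h s"
      using AE_completion[OF fg] by eventually_elim (use bound in \<open>fastforce simp: h_def indicator_def\<close>)
  qed
qed

theorem corollary1p1:
  fixes \<alpha> :: real and f :: "real \<Rightarrow> real" and i :: nat
  assumes "0 < \<alpha>" and "\<alpha> < 1"
    and "f \<in> borel_measurable (lebesgue_on {0..1})"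
    and "bdd_above ((\<lambda>s. \<bar>f s\<bar> * s powr (1 - \<alpha>)) ` {0<..1})"
    and "i \<in> {1, 2, 3}"
  shows "(\<forall>t\<in>{0<..<1}. set_integrable lebesgue {0<..<t}
            (\<lambda>s. f s * f t / (t - s) powr \<alpha> * beta_weight \<alpha> i t)) \<and>
         set_integrable lebesgue {0<..<1}
            (\<lambda>t. LINT s:{0<..<t}|lebesgue. f s * f t / (t - s) powr \<alpha> * beta_weight \<alpha> i t) \<and>
         (LINT t:{0<..<1}|lebesgue. LINT s:{0<..<t}|lebesgue.
            f s * f t / (t - s) powr \<alpha> * beta_weight \<alpha> i t) \<ge> 0"
proof -
  obtain C where "\<And>s. s \<in> {0<..1} \<Longrightarrow> \<bar>f s\<bar> * s powr (1 - \<alpha>) \<le> C"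
    using assms(4) unfolding bdd_above_def by (meson imageI)
  then have f_bound: "\<bar>f s\<bar> \<le> C * s powr (\<alpha> - 1)" if "s \<in> {0<..<1}" for s
    using that by (force simp: powr_diff field_simps)
  have "(\<lambda>s. C * s powr (\<alpha> - 1)) \<in> borel_measurable borel" by measurable
  from borel_representative[OF assms(3) this f_bound]
  obtain h where h_meas [measurable]: "h \<in> borel_measurable borel"
    and h_bound: "\<And>s. s \<in> {0<..<1} \<Longrightarrow> \<bar>h s\<bar> \<le> C * s powr (\<alpha> - 1)"
    and h_zero: "\<And>s. s \<notin> {0<..<1} \<Longrightarrow> h s = 0"
    and fh: "AE s in lebesgue. s \<in> {0<..<1} \<longrightarrow> f s = h s"
    by blast
  \<comment> \<open>The inner integral of \<open>f\<close> needs care: its value at \<open>t\<close> involves \<open>f t\<close>, which may differ from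
    \<open>h t\<close>. So \<open>f t\<close> is kept as a factor and only the integral \<open>J t\<close> is computed with \<open>h\<close>.\<close>
  define H where "H t s = (if s < t then h s * h t / (t - s) powr \<alpha> * beta_weight \<alpha> i t else 0)" for t s
  have H_int: "integrable (lborel \<Otimes>\<^sub>M lborel) (\<lambda>(t, s). H t s)"
    unfolding H_def
    by (rule integrable_half_square_form) (use assms h_bound h_zero abs_beta_weight_le in auto)
  define J where "J t = (\<integral>s. (if s < t then h s / (t - s) powr \<alpha> else 0) \<partial>lborel)" for t
  have J_meas [measurable]: "J \<in> borel_measurable borel"
    unfolding J_def[abs_def] by measurable
  have HJ: "(\<integral>s. H t s \<partial>lborel) = h t * beta_weight \<alpha> i t * J t" for t
  proof -
    have "H t s = h t * beta_weight \<alpha> i t * (if s < t then h s / (t - s) powr \<alpha> else 0)" for s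
      by (simp add: H_def)
    then show ?thesis by (simp add: J_def)
  qed
  have f_meas: "(\<lambda>s. indicator {0..1} s * f s) \<in> borel_measurable lebesgue"
    using assms(3) by (simp add: borel_measurable_restrict_space_iff)
  have inner: "has_bochner_integral lebesgue (\<lambda>s. indicator {0<..<t} s * (f s / (t - s) powr \<alpha>)) (J t)"
    if t: "t \<in> {0<..<1}" for t
  proof -
    let ?f = "\<lambda>s. indicator {0<..<t} s * (f s / (t - s) powr \<alpha>)"
    let ?h = "\<lambda>s. if s < t then h s / (t - s) powr \<alpha> else 0"
    have "integrable lborel (\<lambda>s. C * (indicator {0<..<t} s * (s powr (\<alpha> - 1) / (t - s) powr \<alpha>)))"
      using has_bochner_integral_Beta_scaled[of \<alpha> t] assms t
      by (intro integrable_mult_right) (auto simp: has_bochner_integral_iff)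
    then have h_int: "integrable lborel ?h"
    proof (rule Bochner_Integration.integrable_bound)
      show "AE s in lborel. norm (?h s) \<le> norm (C * (indicator {0<..<t} s * (s powr (\<alpha> - 1) / (t - s) powr \<alpha>)))"
      proof (rule AE_I2)
        fix s :: real
        show "norm (?h s) \<le> norm (C * (indicator {0<..<t} s * (s powr (\<alpha> - 1) / (t - s) powr \<alpha>)))"
        proof (cases "s \<in> {0<..<t}")
          case True
          then have "\<bar>h s\<bar> / (t - s) powr \<alpha> \<le> C * s powr (\<alpha> - 1) / (t - s) powr \<alpha>"
            using t by (intro divide_right_mono h_bound) auto
          also have "\<dots> \<le> \<bar>C * s powr (\<alpha> - 1) / (t - s) powr \<alpha>\<bar>" by (rule abs_ge_self)
          finally show ?thesis using True by (simp add: abs_mult)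
        qed (use h_zero[of s] in auto)
      qed
    qed measurable
    have eq: "AE s in lebesgue. ?h s = ?f s"
      using fh by eventually_elim (use t h_zero in \<open>auto simp: indicator_def\<close>)
    have "(\<lambda>s. indicator {0<..<t} s / (t - s) powr \<alpha>) \<in> borel_measurable lebesgue"
      by (intro measurable_completion) measurable
    from borel_measurable_times[OF f_meas this]
    have "(\<lambda>s. indicator {0..1} s * f s * (indicator {0<..<t} s / (t - s) powr \<alpha>)) \<in> borel_measurable lebesgue" .
    also have "(\<lambda>s. indicator {0..1} s * f s * (indicator {0<..<t} s / (t - s) powr \<alpha>)) = ?f"
      using t by (auto simp: indicator_def)
    finally have f_meas': "?f \<in> borel_measurable lebesgue" .
    have "has_bochner_integral lebesgue ?h (J t)"
      using h_int by (simp add: has_bochner_integral_iff J_def integrable_completion integral_completion)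
    then show ?thesis
      by (rule has_bochner_integralI_AE[OF _ f_meas' eq])
  qed
  have inner_weighted: "has_bochner_integral lebesgue
      (\<lambda>s. indicator {0<..<t} s *\<^sub>R (f s * f t / (t - s) powr \<alpha> * beta_weight \<alpha> i t))
      (f t * beta_weight \<alpha> i t * J t)" if t: "t \<in> {0<..<1}" for t
    using has_bochner_integral_mult_right[OF inner[OF t], of "f t * beta_weight \<alpha> i t"] by (simp add: mult_ac)
  define I where "I t = (LINT s:{0<..<t}|lebesgue. f s * f t / (t - s) powr \<alpha> * beta_weight \<alpha> i t)" for t
  have I_eq: "I t = f t * beta_weight \<alpha> i t * J t" if "t \<in> {0<..<1}" for t
    using inner_weighted[OF that] by (simp add: I_def set_lebesgue_integral_def has_bochner_integral_iff)
  have outer: "has_bochner_integral lebesgue (\<lambda>t. indicator {0<..<1} t *\<^sub>R I t) (\<integral>t. (\<integral>s. H t s \<partial>lborel) \<partial>lborel)"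
  proof (rule has_bochner_integralI_AE)
    have "(\<lambda>t. indicator {0<..<1} t * (beta_weight \<alpha> i t * J t)) \<in> borel_measurable lebesgue"
      by (intro measurable_completion) measurable
    from borel_measurable_times[OF f_meas this]
    have "(\<lambda>t. indicator {0..1} t * f t * (indicator {0<..<1} t * (beta_weight \<alpha> i t * J t))) \<in> borel_measurable lebesgue" .
    also have "(\<lambda>t. indicator {0..1} t * f t * (indicator {0<..<1} t * (beta_weight \<alpha> i t * J t))) =
        (\<lambda>t. indicator {0<..<1} t *\<^sub>R I t)"
      by (auto simp: indicator_def I_eq)
    finally show "(\<lambda>t. indicator {0<..<1} t *\<^sub>R I t) \<in> borel_measurable lebesgue" .
    show "AE t in lebesgue. (\<integral>s. H t s \<partial>lborel) = indicator {0<..<1} t *\<^sub>R I t"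
      using fh by eventually_elim (use h_zero in \<open>auto simp: HJ I_eq indicator_def\<close>)
    have "integrable lborel (\<lambda>t. \<integral>s. H t s \<partial>lborel)"
      using lborel_pair.integrable_fst'[OF H_int] by simp
    then show "has_bochner_integral lebesgue (\<lambda>t. \<integral>s. H t s \<partial>lborel) (\<integral>t. (\<integral>s. H t s \<partial>lborel) \<partial>lborel)"
      by (simp add: has_bochner_integral_iff integrable_completion integral_completion)
  qed
  have "(\<integral>t. (\<integral>s. H t s \<partial>lborel) \<partial>lborel) \<ge> 0"
    unfolding H_def
    by (rule beta_weight_half_square_form_nonneg)
      (use assms h_meas h_zero H_int[unfolded H_def] in auto)
  then show ?thesis
    using inner_weighted outer
    unfolding I_def by (auto simp: set_integrable_def set_lebesgue_integral_def has_bochner_integral_iff)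
qed

end
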